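(* Let $f\in C([0,1]^5)$, let $$F(t,x(\cdot),y(\cdot))=\iint_{\Delta_2} f(t,z_1,z_2,x(z_1),y(z_2))\,dz_1\,dz_2,\qquad \Delta_2=\{(z_1,z_2): z_1\ge0,\ z_2\ge0,\ z_1+z_2\le1\},$$ be the corresponding Urison operator, considered on the set $\Phi$ of pairs $(x,y)$ with $x,y\in C[0,1]$, $x(z_1)\ge 0$, $y(z_2)\ge 0$ and $x(z_1)+y(z_2)\le1$ for all $(z_1,z_2)\in\Delta_2$. Let $0\le\alpha=\alpha(m)\to0$ as $m\to\infty$. Then the sequence $P_m^{[\alpha]}(F,x(\cdot),y(\cdot))$ converges to $F(t,x(\cdot),y(\cdot))$ as $m\to\infty$, uniformly with respect to $(x,y)\in\Phi$ (for each $t\in[0,1]$).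
   Context: For $m\ge1$, a parameter $\alpha\ge 0$ (which may depend only on $m$), $t\in[0,1]$ and $(x,y)\in\Phi$, the operator polynomial is $$P_m^{[\alpha]}(F,x(\cdot),y(\cdot))=\iint_{\Delta_2}\sum_{i,j\ge 0,\ i+j\le m} \frac{m!}{i!\,j!\,(m-i-j)!}\, v_m^{(i,j)}(x(z_1),y(z_2),\alpha)\, f\left(t,z_1,z_2,\frac im,\frac jm\right)dz_1\,dz_2,$$ where $$v_m^{(i,j)}(x,y,\alpha)=\frac{\prod_{k_1=0}^{i-1}(x+k_1\alpha)\,\prod_{k_2=0}^{j-1}(y+k_2\alpha)\,\prod_{k_3=0}^{m-i-j-1}(1-x-y+k_3\alpha)}{\prod_{k_4=0}^{m-1}(1+k_4\alpha)},$$ and empty products equal $1$. *)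

theory Defs
  imports "HOL-Analysis.Analysis"
begin

definition Delta2 :: "(real \<times> real) set" where
  "Delta2 = {(z1, z2). 0 \<le> z1 \<and> 0 \<le> z2 \<and> z1 + z2 \<le> 1}"

(* Elements of C[0,1] are represented by total functions that are continuous on {0..1};
   their values outside {0..1} are never used. *)
definition Phi :: "((real \<Rightarrow> real) \<times> (real \<Rightarrow> real)) set" where
  "Phi = {(x, y). continuous_on {0..1} x \<and> continuous_on {0..1} y \<and>
            (\<forall>(z1, z2) \<in> Delta2. 0 \<le> x z1 \<and> 0 \<le> y z2 \<and> x z1 + y z2 \<le> 1)}"

definition urison ::
  "(real \<times> real \<times> real \<times> real \<times> real \<Rightarrow> real) \<Rightarrow> real \<Rightarrow> (real \<Rightarrow> real) \<Rightarrow> (real \<Rightarrow> real) \<Rightarrow> real" where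
  "urison f t x y = (LINT z:Delta2|lborel. f (t, fst z, snd z, x (fst z), y (snd z)))"

definition v_coeff :: "nat \<Rightarrow> nat \<Rightarrow> nat \<Rightarrow> real \<Rightarrow> real \<Rightarrow> real \<Rightarrow> real" where
  "v_coeff m i j x y \<alpha> =
     ((\<Prod>k<i. x + real k * \<alpha>) * (\<Prod>k<j. y + real k * \<alpha>) * (\<Prod>k<m - i - j. 1 - x - y + real k * \<alpha>))
     / (\<Prod>k<m. 1 + real k * \<alpha>)"

(* P_m(F, x, y) is built from the kernel f of the operator F, which is therefore the argument. *)
definition operator_poly ::
  "nat \<Rightarrow> real \<Rightarrow> (real \<times> real \<times> real \<times> real \<times> real \<Rightarrow> real) \<Rightarrow> real \<Rightarrow> (real \<Rightarrow> real) \<Rightarrow> (real \<Rightarrow> real) \<Rightarrow> real" where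
  "operator_poly m \<alpha> f t x y =
     (LINT z:Delta2|lborel.
        (\<Sum>(i, j) \<in> {(i, j). i + j \<le> m}.
           fact m / (fact i * fact j * fact (m - i - j)) * v_coeff m i j (x (fst z)) (y (snd z)) \<alpha>
           * f (t, fst z, snd z, real i / real m, real j / real m)))"

end

theory Submission imports Defs begin

text \<open>
  The operator polynomial is, at every point of the triangle, an average: it replaces the value of
  the kernel at \<open>(x, y) = (x(z\<^sub>1), y(z\<^sub>2))\<close> by a weighted mean of its values at the nodes
  \<open>(i/m, j/m)\<close>.  The weights are the probabilities of drawing \<open>i\<close> balls of the first and \<open>j\<close> of
  the second of three colours in \<open>m\<close> draws from a Polya urn: it starts with proportions
  \<open>x\<close>, \<open>y\<close>, \<open>1 - x - y\<close>, and each draw adds an amount \<open>\<alpha>\<close> of the drawn colour.  Convergence is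
  Chebyshev's argument for Bernstein polynomials with the Polya urn instead of independent draws.

  The weights are nonnegative and sum to 1, and the mean of \<open>i/m\<close> is \<open>x\<close>.  Forgetting the
  difference between the second and the third colour leaves a two-colour urn
  (\<open>polya_weight_marginal\<close>), whose variance follows from the one-draw recursion
  \<open>polya_sum_Suc\<close>:  \<open>x (1 - x) (1/m + \<alpha>) / (1 + \<alpha>) \<le> (1/m + \<alpha>) / 4\<close>.  This bound tends to 0
  because \<open>\<alpha>\<close> does, and it does not depend on \<open>x\<close>, which is where uniformity comes from.

  A continuous kernel on the compact cube satisfies
  \<open>\<bar>f p - f q\<bar> \<le> \<epsilon> + K (dist p q)\<^sup>2\<close>  for every \<open>\<epsilon> > 0\<close> with a suitable \<open>K\<close>
  (\<open>continuous_on_compact_quadratic_modulus\<close>).  Averaging this over the weights bounds the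
  pointwise error by \<open>\<epsilon> + K (1/m + \<alpha>) / 2\<close> (\<open>polya_average_error\<close>).  The triangle has area at
  most 1, so the integrals obey the same bound (\<open>operator_poly_error\<close>).
\<close>

section \<open>Moments of the two-colour Polya urn\<close>

text \<open>
  The rising factorial with step \<open>\<alpha>\<close>: the power \<open>x ^ n\<close> for \<open>\<alpha> = 0\<close> and the Pochhammer symbol
  for \<open>\<alpha> = 1\<close>.
\<close>
definition rising :: "real \<Rightarrow> real \<Rightarrow> nat \<Rightarrow> real" where
  "rising \<alpha> x n = (\<Prod>k<n. x + real k * \<alpha>)"

lemma rising_0 [simp]: "rising \<alpha> x 0 = 1"
  by (simp add: rising_def)

lemma rising_Suc: "rising \<alpha> x (Suc n) = (x + real n * \<alpha>) * rising \<alpha> x n"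
  by (simp add: rising_def mult.commute)

lemma rising_nonneg: "0 \<le> x \<Longrightarrow> 0 \<le> \<alpha> \<Longrightarrow> 0 \<le> rising \<alpha> x n"
  by (simp add: rising_def prod_nonneg)

lemma rising_pos: "0 < x \<Longrightarrow> 0 \<le> \<alpha> \<Longrightarrow> 0 < rising \<alpha> x n"
  by (simp add: rising_def prod_pos add_pos_nonneg)

text \<open>
  Up to the factor \<open>1 / rising \<alpha> (x + y) m\<close>, this is the expectation of \<open>g\<close> at the number of balls
  of the first colour after \<open>m\<close> draws.  Leaving that factor out keeps the identities below free of
  divisions.
\<close>
definition polya_sum :: "real \<Rightarrow> real \<Rightarrow> real \<Rightarrow> nat \<Rightarrow> (nat \<Rightarrow> real) \<Rightarrow> real" where
  "polya_sum \<alpha> x y m g =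
     (\<Sum>i\<le>m. real (m choose i) * rising \<alpha> x i * rising \<alpha> y (m - i) * g i)"

lemma polya_sum_0 [simp]: "polya_sum \<alpha> x y 0 g = g 0"
  by (simp add: polya_sum_def)

lemma polya_sum_add:
  "polya_sum \<alpha> x y m (\<lambda>i. g i + h i) = polya_sum \<alpha> x y m g + polya_sum \<alpha> x y m h"
  by (simp add: polya_sum_def algebra_simps sum.distrib)

lemma polya_sum_scale:
  "polya_sum \<alpha> x y m (\<lambda>i. c * g i) = c * polya_sum \<alpha> x y m g"
  by (simp add: polya_sum_def sum_distrib_left mult_ac)

lemma polya_sum_cong:
  "(\<And>i. i \<le> m \<Longrightarrow> g i = h i) \<Longrightarrow> polya_sum \<alpha> x y m g = polya_sum \<alpha> x y m h"
  by (auto simp: polya_sum_def)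

text \<open>
  One more draw from the urn: after \<open>i\<close> balls of the first colour among \<open>m\<close>, its amount is
  \<open>x + i \<alpha>\<close> and that of the second is \<open>y + (m - i) \<alpha>\<close>.  Algebraically it is Pascal's rule, and every
  moment is computed from it by induction on \<open>m\<close>.
\<close>
lemma polya_sum_Suc:
  "polya_sum \<alpha> x y (Suc m) g =
   polya_sum \<alpha> x y m (\<lambda>i. (y + real (m - i) * \<alpha>) * g i + (x + real i * \<alpha>) * g (Suc i))"
proof -
  define w where "w i = rising \<alpha> x i * rising \<alpha> y (Suc m - i) * g i" for i
  have "polya_sum \<alpha> x y (Suc m) g = (\<Sum>i\<le>Suc m. real (Suc m choose i) * w i)"
    by (simp add: polya_sum_def w_def mult_ac)
  also have "\<dots> = w 0 + (\<Sum>i\<le>m. real (m choose Suc i) * w (Suc i)) + (\<Sum>i\<le>m. real (m choose i) * w (Suc i))"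
    by (subst sum.atMost_Suc_shift) (simp add: algebra_simps sum.distrib)
  also have "w 0 + (\<Sum>i\<le>m. real (m choose Suc i) * w (Suc i)) = (\<Sum>i\<le>Suc m. real (m choose i) * w i)"
    by (subst sum.atMost_Suc_shift) simp
  also have "\<dots> = (\<Sum>i\<le>m. real (m choose i) * w i)"
    by simp
  finally show ?thesis
    unfolding polya_sum_def sum.distrib [symmetric]
    by (auto intro!: sum.cong simp: w_def rising_Suc Suc_diff_le algebra_simps)
qed

text \<open>
  The Chu--Vandermonde identity; for \<open>\<alpha> = 0\<close> it is the binomial theorem.
\<close>
lemma polya_sum_one: "polya_sum \<alpha> x y m (\<lambda>i. 1) = rising \<alpha> (x + y) m"
proof (induction m)
  case (Suc m)
  have "polya_sum \<alpha> x y (Suc m) (\<lambda>i. 1) = polya_sum \<alpha> x y m (\<lambda>i. (x + y + real m * \<alpha>) * 1)"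
    unfolding polya_sum_Suc by (rule polya_sum_cong) (simp add: of_nat_diff algebra_simps)
  then show ?case
    unfolding polya_sum_scale by (simp add: Suc.IH rising_Suc)
qed simp

lemma polya_sum_mean_deviation: "polya_sum \<alpha> x (1 - x) m (\<lambda>i. real i - real m * x) = 0"
proof (induction m)
  case (Suc m)
  have "polya_sum \<alpha> x (1 - x) (Suc m) (\<lambda>i. real i - real (Suc m) * x)
      = polya_sum \<alpha> x (1 - x) m (\<lambda>i. (1 + real (Suc m) * \<alpha>) * (real i - real m * x))"
    unfolding polya_sum_Suc by (rule polya_sum_cong) (simp add: of_nat_diff algebra_simps)
  then show ?case
    unfolding polya_sum_scale by (simp add: Suc.IH)
qed simp

text \<open>
  Under one draw the squared deviation is multiplied by \<open>1 + (m + 2) \<alpha>\<close>, apart from a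
  multiple of the deviation itself, whose sum vanishes, and a constant.  The factor \<open>1 + \<alpha>\<close> on the
  left clears the denominator of the closed form.
\<close>
lemma polya_sum_variance:
  "(1 + \<alpha>) * polya_sum \<alpha> x (1 - x) m (\<lambda>i. (real i - real m * x)\<^sup>2)
    = real m * x * (1 - x) * (1 + real m * \<alpha>) * rising \<alpha> 1 m"
proof (induction m)
  case (Suc m)
  let ?d = "\<lambda>i. real i - real m * x"
  have "polya_sum \<alpha> x (1 - x) (Suc m) (\<lambda>i. (real i - real (Suc m) * x)\<^sup>2)
      = polya_sum \<alpha> x (1 - x) m (\<lambda>i. (1 + (real m + 2) * \<alpha>) * (?d i)\<^sup>2 +
          (\<alpha> * (1 - 2 * x) * ?d i + x * (1 - x) * (1 + real m * \<alpha>) * 1))"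
    unfolding polya_sum_Suc
    by (rule polya_sum_cong) (simp add: of_nat_diff power2_eq_square algebra_simps)
  also have "\<dots> = (1 + (real m + 2) * \<alpha>) * polya_sum \<alpha> x (1 - x) m (\<lambda>i. (?d i)\<^sup>2)
      + x * (1 - x) * (1 + real m * \<alpha>) * rising \<alpha> 1 m"
    unfolding polya_sum_add polya_sum_scale polya_sum_one polya_sum_mean_deviation by simp
  finally have step: "polya_sum \<alpha> x (1 - x) (Suc m) (\<lambda>i. (real i - real (Suc m) * x)\<^sup>2)
      = (1 + (real m + 2) * \<alpha>) * polya_sum \<alpha> x (1 - x) m (\<lambda>i. (?d i)\<^sup>2)
      + x * (1 - x) * (1 + real m * \<alpha>) * rising \<alpha> 1 m" .
  have "(1 + \<alpha>) * polya_sum \<alpha> x (1 - x) (Suc m) (\<lambda>i. (real i - real (Suc m) * x)\<^sup>2)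
      = (1 + (real m + 2) * \<alpha>) * ((1 + \<alpha>) * polya_sum \<alpha> x (1 - x) m (\<lambda>i. (?d i)\<^sup>2))
      + (1 + \<alpha>) * (x * (1 - x) * (1 + real m * \<alpha>) * rising \<alpha> 1 m)"
    unfolding step
    by (simp add: algebra_simps)
  then show ?case
    unfolding Suc.IH by (simp add: rising_Suc algebra_simps)
qed simp

section \<open>The three-colour weights\<close>

definition polya_weight :: "real \<Rightarrow> real \<Rightarrow> real \<Rightarrow> nat \<Rightarrow> nat \<Rightarrow> nat \<Rightarrow> real" where
  "polya_weight \<alpha> x y m i j = fact m / (fact i * fact j * fact (m - i - j)) * v_coeff m i j x y \<alpha>"

lemma v_coeff_rising:
  "v_coeff m i j x y \<alpha> =
     rising \<alpha> x i * rising \<alpha> y j * rising \<alpha> (1 - x - y) (m - i - j) / rising \<alpha> 1 m"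
  by (simp add: v_coeff_def rising_def)

lemma polya_weight_commute: "polya_weight \<alpha> x y m i j = polya_weight \<alpha> y x m j i"
proof -
  have swap: "1 - x - y = 1 - y - x" "m - i - j = m - j - i"
    by auto
  show ?thesis
    unfolding polya_weight_def v_coeff_rising swap by (simp add: mult_ac)
qed

lemma polya_weight_nonneg:
  assumes "0 \<le> \<alpha>" "0 \<le> x" "0 \<le> y" "x + y \<le> 1"
  shows "0 \<le> polya_weight \<alpha> x y m i j"
  using assms by (simp add: polya_weight_def v_coeff_rising rising_nonneg)

lemma multinomial_eq_choose:
  assumes "i + j \<le> m"
  shows "(fact m / (fact i * fact j * fact (m - i - j)) :: real)
    = real (m choose i) * real ((m - i) choose j)"
  using assms by (simp add: binomial_fact)

lemma polya_weight_eq_choose: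
  assumes "i + j \<le> m"
  shows "polya_weight \<alpha> x y m i j = real (m choose i) * rising \<alpha> x i / rising \<alpha> 1 m
    * (real ((m - i) choose j) * rising \<alpha> y j * rising \<alpha> (1 - x - y) (m - i - j))"
  unfolding polya_weight_def v_coeff_rising multinomial_eq_choose [OF assms] by simp

lemma triangle_eq_Sigma: "{(i, j). i + j \<le> m} = (SIGMA i:{..m::nat}. {..m - i})"
  by auto

text \<open>
  Merging the second and the third colour: for fixed \<open>i\<close> the sum over \<open>j\<close> is again of
  Chu--Vandermonde type, with parameters \<open>y\<close> and \<open>1 - x - y\<close>, and so it depends on \<open>1 - x\<close> only.
\<close>
lemma polya_weight_marginal:
  "(\<Sum>(i, j)\<in>{(i, j). i + j \<le> m}. polya_weight \<alpha> x y m i j * g i)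
    = polya_sum \<alpha> x (1 - x) m g / rising \<alpha> 1 m"
proof -
  have inner: "(\<Sum>j\<le>m - i. polya_weight \<alpha> x y m i j)
      = real (m choose i) * rising \<alpha> x i * rising \<alpha> (1 - x) (m - i) / rising \<alpha> 1 m"
    if "i \<le> m" for i
  proof -
    have "(\<Sum>j\<le>m - i. polya_weight \<alpha> x y m i j)
        = real (m choose i) * rising \<alpha> x i / rising \<alpha> 1 m
          * polya_sum \<alpha> y (1 - x - y) (m - i) (\<lambda>j. 1)"
      unfolding polya_sum_def sum_distrib_left
      by (intro sum.cong refl, subst polya_weight_eq_choose) (use that in auto)
    then show ?thesis
      by (simp add: polya_sum_one)
  qed
  have "(\<Sum>(i, j)\<in>{(i, j). i + j \<le> m}. polya_weight \<alpha> x y m i j * g i)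
      = (\<Sum>i\<le>m. (\<Sum>j\<le>m - i. polya_weight \<alpha> x y m i j) * g i)"
    unfolding triangle_eq_Sigma by (subst sum.Sigma [symmetric]) (auto simp: sum_distrib_right)
  also have "\<dots> = polya_sum \<alpha> x (1 - x) m g / rising \<alpha> 1 m"
    by (simp add: inner polya_sum_def sum_divide_distrib)
  finally show ?thesis .
qed

lemma polya_weight_sum:
  assumes "0 \<le> \<alpha>"
  shows "(\<Sum>(i, j)\<in>{(i, j). i + j \<le> m}. polya_weight \<alpha> x y m i j) = 1"
proof -
  have "rising \<alpha> 1 m \<noteq> 0"
    using rising_pos [of 1 \<alpha> m] assms by simp
  then show ?thesis
    using polya_weight_marginal [where g = "\<lambda>i. 1"] by (simp add: polya_sum_one)
qed

text \<open>
  The exact value is \<open>x (1 - x) (1/m + \<alpha>) / (1 + \<alpha>)\<close>; the estimate removes the dependence on \<open>x\<close>.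
\<close>
lemma polya_weight_variance_le:
  assumes "0 \<le> \<alpha>" "m \<ge> 1" "0 \<le> x" "x \<le> 1"
  shows "(\<Sum>(i, j)\<in>{(i, j). i + j \<le> m}. polya_weight \<alpha> x y m i j * (real i / real m - x)\<^sup>2)
    \<le> (1 / real m + \<alpha>) / 4"
proof -
  let ?R = "rising \<alpha> 1 m"
  have m: "real m > 0" and R: "?R > 0" and a: "1 + \<alpha> > 0"
    using assms rising_pos [of 1 \<alpha> m] by auto
  have scaled: "(real i / real m - x)\<^sup>2 = (1 / (real m)\<^sup>2) * (real i - real m * x)\<^sup>2" for i
    using m by (simp add: field_simps power2_eq_square)
  have "(\<Sum>(i, j)\<in>{(i, j). i + j \<le> m}. polya_weight \<alpha> x y m i j * (real i / real m - x)\<^sup>2)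
      = polya_sum \<alpha> x (1 - x) m (\<lambda>i. (real i - real m * x)\<^sup>2) / ((real m)\<^sup>2 * ?R)"
    unfolding polya_weight_marginal scaled polya_sum_scale by simp
  also have "polya_sum \<alpha> x (1 - x) m (\<lambda>i. (real i - real m * x)\<^sup>2)
      = real m * x * (1 - x) * (1 + real m * \<alpha>) * ?R / (1 + \<alpha>)"
    using polya_sum_variance [of \<alpha> x m] a by (simp add: field_simps)
  also have "\<dots> / ((real m)\<^sup>2 * ?R) = x * (1 - x) * ((1 / real m + \<alpha>) / (1 + \<alpha>))"
  proof -
    have "1 + real m * \<alpha> = real m * (1 / real m + \<alpha>)"
      using m by (simp add: field_simps)
    then show ?thesis
      using m R by (simp add: power2_eq_square)
  qed
  also have "\<dots> \<le> 1 / 4 * (1 / real m + \<alpha>)"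
  proof (rule mult_mono)
    have "0 \<le> (x - 1 / 2)\<^sup>2"
      by simp
    then show "x * (1 - x) \<le> 1 / 4"
      by (simp add: power2_eq_square field_simps)
    have "(1 / real m + \<alpha>) * 1 \<le> (1 / real m + \<alpha>) * (1 + \<alpha>)"
      using assms by (intro mult_left_mono) auto
    then show "(1 / real m + \<alpha>) / (1 + \<alpha>) \<le> 1 / real m + \<alpha>"
      using a by (simp add: pos_divide_le_eq)
  qed (use assms in auto)
  finally show ?thesis
    by simp
qed

text \<open>
  Chebyshev's step: the error of the average is at most the average of the errors, and the
  averages of the two squares are variances, that of \<open>j/m\<close> by the symmetry of the two colours.
\<close>
lemma polya_average_error:
  assumes "0 \<le> \<alpha>" "m \<ge> 1" "0 \<le> x" "0 \<le> y" "x + y \<le> 1" "0 \<le> K"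
    and close: "\<And>i j. i + j \<le> m \<Longrightarrow>
      \<bar>g i j - c\<bar> \<le> e + K * ((real i / real m - x)\<^sup>2 + (real j / real m - y)\<^sup>2)"
  shows "\<bar>(\<Sum>(i, j)\<in>{(i, j). i + j \<le> m}. polya_weight \<alpha> x y m i j * g i j) - c\<bar>
    \<le> e + K * (1 / real m + \<alpha>) / 2"
proof -
  let ?T = "{(i, j). i + j \<le> m}"
  let ?w = "\<lambda>(i, j). polya_weight \<alpha> x y m i j"
  let ?u = "\<lambda>(i, j). (real i / real m - x)\<^sup>2" and ?v = "\<lambda>(i, j). (real j / real m - y)\<^sup>2"
  have one: "(\<Sum>p\<in>?T. ?w p) = 1"
    using polya_weight_sum [OF assms(1)] by simp
  have U: "(\<Sum>p\<in>?T. ?w p * ?u p) \<le> (1 / real m + \<alpha>) / 4"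
    using polya_weight_variance_le [of \<alpha> m x y] assms by (simp add: case_prod_beta)
  have swap: "prod.swap ` ?T = ?T"
    by (force simp: image_iff)
  have "(\<Sum>p\<in>?T. ?w p * ?v p)
      = (\<Sum>(j, i)\<in>?T. polya_weight \<alpha> y x m j i * (real j / real m - y)\<^sup>2)"
    by (subst (1) swap [symmetric], subst sum.reindex)
       (auto simp: case_prod_beta intro!: sum.cong polya_weight_commute)
  also have "\<dots> \<le> (1 / real m + \<alpha>) / 4"
    using assms by (intro polya_weight_variance_le) auto
  finally have V: "(\<Sum>p\<in>?T. ?w p * ?v p) \<le> (1 / real m + \<alpha>) / 4" .
  have "(\<Sum>(i, j)\<in>?T. polya_weight \<alpha> x y m i j * g i j) - c
      = (\<Sum>p\<in>?T. ?w p * (g (fst p) (snd p) - c))"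
    using one by (simp add: right_diff_distrib sum_subtractf case_prod_beta flip: sum_distrib_right)
  also have "\<bar>\<dots>\<bar> \<le> (\<Sum>p\<in>?T. ?w p * \<bar>g (fst p) (snd p) - c\<bar>)"
    using polya_weight_nonneg [OF assms(1,3,4,5)]
    by (intro order_trans [OF sum_abs]) (auto simp: abs_mult intro!: sum_mono)
  also have "\<dots> \<le> (\<Sum>p\<in>?T. ?w p * (e + K * (?u p + ?v p)))"
    using polya_weight_nonneg [OF assms(1,3,4,5)]
    by (intro sum_mono mult_left_mono) (auto intro: close)
  also have "\<dots> = (\<Sum>p\<in>?T. e * ?w p + K * (?w p * ?u p) + K * (?w p * ?v p))"
    by (intro sum.cong refl) (simp add: algebra_simps)
  also have "\<dots> = e + K * (\<Sum>p\<in>?T. ?w p * ?u p) + K * (\<Sum>p\<in>?T. ?w p * ?v p)"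
    using one by (simp add: sum.distrib flip: sum_distrib_left)
  also have "\<dots> \<le> e + K * ((1 / real m + \<alpha>) / 4) + K * ((1 / real m + \<alpha>) / 4)"
    using U V \<open>0 \<le> K\<close> by (intro add_mono mult_left_mono) auto
  finally show ?thesis
    by simp
qed

section \<open>A quadratic modulus of continuity\<close>

text \<open>
  Points closer than the \<open>\<delta>\<close> of uniform continuity are covered by \<open>e\<close>.  For the others
  \<open>(dist p q / \<delta>)\<^sup>2 \<ge> 1\<close>, so \<open>K = 2 B / \<delta>\<^sup>2\<close> suffices, where \<open>B\<close> bounds \<open>\<bar>f\<bar>\<close>.
  The square makes the bound averageable by means of variances.
\<close>
lemma continuous_on_compact_quadratic_modulus:
  fixes f :: "'a::metric_space \<Rightarrow> real"
  assumes f: "continuous_on S f" and S: "compact S" and e: "0 < e"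
  obtains K where "0 \<le> K" "\<And>p q. p \<in> S \<Longrightarrow> q \<in> S \<Longrightarrow> \<bar>f p - f q\<bar> \<le> e + K * (dist p q)\<^sup>2"
proof -
  obtain d where d: "d > 0" "\<And>p q. p \<in> S \<Longrightarrow> q \<in> S \<Longrightarrow> dist q p < d \<Longrightarrow> dist (f q) (f p) < e"
    using compact_uniformly_continuous [OF f S] e unfolding uniformly_continuous_on_def by metis
  obtain B where B: "B > 0" "\<And>p. p \<in> S \<Longrightarrow> norm (f p) \<le> B"
    using compact_imp_bounded [OF compact_continuous_image [OF f S]]
    unfolding bounded_pos by auto
  show ?thesis
  proof
    show "0 \<le> 2 * B / d\<^sup>2"
      using B by simp
    fix p q assume pq: "p \<in> S" "q \<in> S"
    show "\<bar>f p - f q\<bar> \<le> e + 2 * B / d\<^sup>2 * (dist p q)\<^sup>2"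
    proof (cases "dist p q < d")
      case True
      then have "\<bar>f p - f q\<bar> < e"
        using d(2) [OF pq(2) pq(1)] by (simp add: dist_real_def)
      moreover have "0 \<le> 2 * B / d\<^sup>2 * (dist p q)\<^sup>2"
        using B by simp
      ultimately show ?thesis
        by linarith
    next
      case False
      then have "d\<^sup>2 \<le> (dist p q)\<^sup>2"
        using d by (intro power_mono) auto
      then have "2 * B \<le> 2 * B / d\<^sup>2 * (dist p q)\<^sup>2"
        using d B by (simp add: field_simps)
      moreover have "\<bar>f p - f q\<bar> \<le> 2 * B"
        using B(2) [OF pq(1)] B(2) [OF pq(2)] by simp
      ultimately show ?thesis
        using e by linarith
    qed
  qed
qed

section \<open>Integration over the triangle\<close>

lemma Delta2_subset_box: "Delta2 \<subseteq> cbox (0, 0) (1, 1)"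
  by (auto simp: Delta2_def cbox_Pair_eq)

lemma compact_Delta2: "compact Delta2"
proof -
  have eq: "Delta2 = {z. 0 \<le> fst z} \<inter> {z. 0 \<le> snd z} \<inter> {z. fst z + snd z \<le> 1}"
    by (auto simp: Delta2_def)
  have "closed Delta2"
    unfolding eq by (intro closed_Int closed_Collect_le continuous_intros)
  then show ?thesis
    using bounded_subset [OF bounded_cbox Delta2_subset_box] by (simp add: compact_eq_bounded_closed)
qed

lemma measure_Delta2_le_1: "measure lborel Delta2 \<le> 1"
proof -
  have "measure lborel Delta2 \<le> measure lborel (cbox (0, 0) (1, 1) :: (real \<times> real) set)"
    by (rule measure_mono_fmeasurable [OF Delta2_subset_box])
       (auto intro: borel_closed compact_imp_closed compact_Delta2)
  also have "\<dots> = 1"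
    by (simp add: content_Pair flip: cbox_Pair_eq)
  finally show ?thesis .
qed

lemma Delta2_integral_diff_le:
  fixes g h :: "real \<times> real \<Rightarrow> real"
  assumes g: "continuous_on Delta2 g" and h: "continuous_on Delta2 h" and "0 \<le> B"
    and le: "\<And>z. z \<in> Delta2 \<Longrightarrow> \<bar>g z - h z\<bar> \<le> B"
  shows "\<bar>(LINT z:Delta2|lborel. g z) - (LINT z:Delta2|lborel. h z)\<bar> \<le> B"
proof -
  have int: "set_integrable lborel Delta2 k" if "continuous_on Delta2 k" for k :: "_ \<Rightarrow> real"
    unfolding set_integrable_def by (rule borel_integrable_compact [OF compact_Delta2 that])
  have "(LINT z:Delta2|lborel. g z) - (LINT z:Delta2|lborel. h z) = (LINT z:Delta2|lborel. g z - h z)"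
    by (rule set_integral_diff(2) [symmetric]) (auto intro: int g h)
  also have "\<bar>\<dots>\<bar> \<le> (LINT z:Delta2|lborel. \<bar>g z - h z\<bar>)"
    using set_integral_norm_bound [OF int [OF continuous_on_diff [OF g h]]] by simp
  also have "\<dots> \<le> (LINT z:Delta2|lborel. B)"
    by (rule set_integral_mono) (auto intro!: int continuous_intros g h le)
  also have "\<dots> = measure lborel Delta2 * B"
    by (simp add: set_lebesgue_integral_def)
  also have "\<dots> \<le> 1 * B"
    using measure_Delta2_le_1 \<open>0 \<le> B\<close> by (rule mult_right_mono)
  finally show ?thesis
    by simp
qed

section \<open>The error of the operator polynomial\<close>

lemma PhiD:
  assumes "(x, y) \<in> Phi" "z \<in> Delta2"
  shows "0 \<le> x (fst z)" "0 \<le> y (snd z)" "x (fst z) + y (snd z) \<le> 1"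
  using assms by (auto simp: Phi_def)

lemma Phi_continuous:
  assumes "(x, y) \<in> Phi"
  shows "continuous_on Delta2 (\<lambda>z. x (fst z))" "continuous_on Delta2 (\<lambda>z. y (snd z))"
proof -
  have "continuous_on {0..1} x" "continuous_on {0..1} y"
    using assms by (auto simp: Phi_def)
  then show "continuous_on Delta2 (\<lambda>z. x (fst z))" "continuous_on Delta2 (\<lambda>z. y (snd z))"
    by (auto intro!: continuous_on_compose2 [of "{0..1}" x] continuous_on_compose2 [of "{0..1}" y]
        continuous_intros simp: Delta2_def)
qed

lemma continuous_on_polya_weight:
  assumes "0 \<le> \<alpha>" "continuous_on S a" "continuous_on S b"
  shows "continuous_on S (\<lambda>z. polya_weight \<alpha> (a z) (b z) m i j)"
proof -
  have "rising \<alpha> 1 m \<noteq> 0"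
    using rising_pos [of 1 \<alpha> m] assms by simp
  then show ?thesis
    unfolding polya_weight_def v_coeff_rising rising_def
    by (auto intro!: continuous_intros assms)
qed

text \<open>
  The pair \<open>(x, y)\<close> does not enter the bound; this gives uniform convergence on \<open>Phi\<close>.
\<close>
lemma operator_poly_error:
  fixes f :: "real \<times> real \<times> real \<times> real \<times> real \<Rightarrow> real"
  defines "Q \<equiv> {0..1} \<times> {0..1} \<times> {0..1} \<times> {0..1} \<times> {0..1}"
  assumes f: "continuous_on Q f"
    and mod: "\<And>p q. p \<in> Q \<Longrightarrow> q \<in> Q \<Longrightarrow> \<bar>f p - f q\<bar> \<le> e + K * (dist p q)\<^sup>2"
    and "0 \<le> e" "0 \<le> K" "0 \<le> \<alpha>" "m \<ge> 1" "t \<in> {0..1}" and xy: "(x, y) \<in> Phi"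
  shows "\<bar>operator_poly m \<alpha> f t x y - urison f t x y\<bar> \<le> e + K * (1 / real m + \<alpha>) / 2"
proof -
  have node: "real i / real m \<in> {0..1}" if "i \<le> m" for i
    using that \<open>m \<ge> 1\<close> by simp
  have Delta2_01: "fst z \<in> {0..1}" "snd z \<in> {0..1}" if "z \<in> Delta2" for z
    using that by (auto simp: Delta2_def)
  have val: "x (fst z) \<in> {0..1}" "y (snd z) \<in> {0..1}" if "z \<in> Delta2" for z
    using PhiD [OF xy that] by auto
  let ?P = "\<lambda>z. \<Sum>(i, j)\<in>{(i, j). i + j \<le> m}. polya_weight \<alpha> (x (fst z)) (y (snd z)) m i j
           * f (t, fst z, snd z, real i / real m, real j / real m)"
  let ?U = "\<lambda>z. f (t, fst z, snd z, x (fst z), y (snd z))"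
  have "\<bar>(LINT z:Delta2|lborel. ?P z) - (LINT z:Delta2|lborel. ?U z)\<bar> \<le> e + K * (1 / real m + \<alpha>) / 2"
  proof (rule Delta2_integral_diff_le)
    show "continuous_on Delta2 ?P"
      unfolding case_prod_beta
      using node Delta2_01 \<open>t \<in> {0..1}\<close> \<open>0 \<le> \<alpha>\<close>
      by (auto intro!: continuous_on_sum continuous_on_mult continuous_on_polya_weight
          Phi_continuous [OF xy] continuous_on_compose2 [OF f] continuous_intros
          simp: Q_def)
    show "continuous_on Delta2 ?U"
      using val Delta2_01 \<open>t \<in> {0..1}\<close>
      by (intro continuous_on_compose2 [OF f] continuous_intros Phi_continuous [OF xy])
         (auto simp: Q_def)
    show "0 \<le> e + K * (1 / real m + \<alpha>) / 2"
      using assms by simp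
    fix z assume z: "z \<in> Delta2"
    show "\<bar>?P z - ?U z\<bar> \<le> e + K * (1 / real m + \<alpha>) / 2"
    proof (rule polya_average_error)
      fix i j assume ij: "i + j \<le> m"
      let ?p = "(t, fst z, snd z, real i / real m, real j / real m)"
      let ?q = "(t, fst z, snd z, x (fst z), y (snd z))"
      \<comment> \<open>The two points differ in the last two coordinates only, so their squared distance is
        exactly the sum of the two squares to be averaged.\<close>
      have "?p \<in> Q" "?q \<in> Q"
        using node [of i] node [of j] ij val [OF z] Delta2_01 [OF z] \<open>t \<in> {0..1}\<close>
        by (simp_all add: Q_def)
      then have "\<bar>f ?p - f ?q\<bar> \<le> e + K * (dist ?p ?q)\<^sup>2"
        by (rule mod)
      also have "(dist ?p ?q)\<^sup>2 = (real i / real m - x (fst z))\<^sup>2 + (real j / real m - y (snd z))\<^sup>2"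
        by (simp add: dist_Pair_Pair dist_real_def)
      finally show "\<bar>f ?p - f ?q\<bar>
        \<le> e + K * ((real i / real m - x (fst z))\<^sup>2 + (real j / real m - y (snd z))\<^sup>2)" .
    qed (use assms PhiD [OF xy z] in auto)
  qed
  then show ?thesis
    by (simp add: operator_poly_def urison_def polya_weight_def)
qed

theorem theorem5:
  fixes f :: "real \<times> real \<times> real \<times> real \<times> real \<Rightarrow> real" and \<alpha> :: "nat \<Rightarrow> real"
  assumes "continuous_on ({0..1} \<times> {0..1} \<times> {0..1} \<times> {0..1} \<times> {0..1}) f"
    and "\<And>m. m \<ge> 1 \<Longrightarrow> 0 \<le> \<alpha> m"
    and "\<alpha> \<longlonglongrightarrow> 0"
  shows "\<forall>t\<in>{0..1}.
    uniform_limit Phi (\<lambda>m (x, y). operator_poly m (\<alpha> m) f t x y) (\<lambda>(x, y). urison f t x y) sequentially"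
proof
  fix t :: real assume t: "t \<in> {0..1}"
  show "uniform_limit Phi (\<lambda>m (x, y). operator_poly m (\<alpha> m) f t x y)
    (\<lambda>(x, y). urison f t x y) sequentially"
  proof (rule uniform_limitI)
    fix e :: real assume "0 < e"
    then have e2: "0 < e / 2"
      by simp
    have "compact ({0..1} \<times> {0..1} \<times> {0..1} \<times> {0..1} \<times> {0..1::real} :: (real \<times> real \<times> real \<times> real \<times> real) set)"
      by (intro compact_Times compact_Icc)
    then obtain K where K: "0 \<le> K"
      "\<And>p q. p \<in> {0..1} \<times> {0..1} \<times> {0..1} \<times> {0..1} \<times> {0..1} \<Longrightarrow>
        q \<in> {0..1} \<times> {0..1} \<times> {0..1} \<times> {0..1} \<times> {0..1} \<Longrightarrow>
        \<bar>f p - f q\<bar> \<le> e / 2 + K * (dist p q)\<^sup>2"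
      using continuous_on_compact_quadratic_modulus [OF assms(1) _ e2] by metis
    have "(\<lambda>m. e / 2 + K * (1 / real m + \<alpha> m) / 2) \<longlonglongrightarrow> e / 2 + K * (0 + 0) / 2"
      by (intro tendsto_intros lim_1_over_n assms(3)) simp_all
    then have "\<forall>\<^sub>F m in sequentially. e / 2 + K * (1 / real m + \<alpha> m) / 2 < e"
      by (rule order_tendstoD) (use \<open>0 < e\<close> in simp)
    then show "\<forall>\<^sub>F m in sequentially. \<forall>p\<in>Phi.
      dist (case p of (x, y) \<Rightarrow> operator_poly m (\<alpha> m) f t x y) (case p of (x, y) \<Rightarrow> urison f t x y) < e"
      using eventually_ge_at_top [of 1]
    proof eventually_elim
      case (elim m)
      show ?case
      proof (clarify)
        fix x y assume "(x, y) \<in> Phi"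
        then have "\<bar>operator_poly m (\<alpha> m) f t x y - urison f t x y\<bar> \<le> e / 2 + K * (1 / real m + \<alpha> m) / 2"
          using operator_poly_error [OF assms(1) K(2)] e2 K(1) assms(2) elim t by simp
        then show "dist (operator_poly m (\<alpha> m) f t x y) (urison f t x y) < e"
          using elim by (simp add: dist_real_def)
      qed
    qed
  qed
qed

end
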